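(* Let $\phi(x) = x^d + c$, where $c,d \in \mathbb{Z}$ and $d \geq 2$. Let $D_{d,c} = \{n \in \mathbb{Z} : n \ge 1,\ n \mid \phi^n(0)\}$ and let $P_{d,c}$ be the set of primes in $D_{d,c}$. Then the following hold. (1) $2 \in P_{d,c}$. (2) Every positive divisor of $c$ is an element of $D_{d,c}$. In particular, if $p$ is prime and $p \mid c$, then $p \in P_{d,c}$. (3) If $p$ is prime and $d \equiv 1 \pmod{p-1}$, then $p \in P_{d,c}$.
   Context: Here $\phi^n$ denotes the $n$-th iterate of $\phi$. *)

theory Defs
  imports Complex_Main "HOL-Computational_Algebra.Primes" "HOL-Number_Theory.Cong"
begin

definition phi :: "nat \<Rightarrow> int \<Rightarrow> int \<Rightarrow> int" where
  "phi d c x = x ^ d + c"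

definition D_set :: "nat \<Rightarrow> int \<Rightarrow> nat set" where
  "D_set d c = {n. n \<ge> 1 \<and> int n dvd (phi d c ^^ n) 0}"

definition P_set :: "nat \<Rightarrow> int \<Rightarrow> nat set" where
  "P_set d c = {p \<in> D_set d c. prime p}"

end

theory Submission
  imports Defs "HOL-Number_Theory.Residues"
begin

text \<open>If \<open>n\<close> divides \<open>c\<close>, the orbit of 0 stays at 0 modulo \<open>n\<close>. If \<open>d \<equiv> 1\<close> modulo \<open>p - 1\<close>, Fermat's
  little theorem makes \<open>\<phi>\<close> the translation by \<open>c\<close> modulo \<open>p\<close>, so \<open>\<phi>\<^sup>p(0) \<equiv> p c \<equiv> 0\<close>; for \<open>p = 2\<close>
  the condition on \<open>d\<close> is void.\<close>

text \<open>Fermat's little theorem for naturals applies to the nonnegative residue of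
  \<open>x\<close> modulo \<open>p\<close>, whose powers are congruent to those of
  \<open>x\<close>.\<close>

lemma fermat_int:
  fixes x :: int
  assumes "prime p" "\<not> int p dvd x"
  shows "[x ^ (p - 1) = 1] (mod int p)"
proof -
  define a where "a = nat (x mod int p)"
  have a: "int a = x mod int p"
    using prime_gt_0_nat[OF assms(1)] by (simp add: a_def)
  have "\<not> p dvd a"
    using assms(2) by (metis a dvd_mod_iff dvd_refl int_dvd_int_iff)
  then have "[int (a ^ (p - 1)) = int 1] (mod int p)"
    using fermat_theorem[OF assms(1)] cong_int_iff by blast
  moreover have "[int a ^ (p - 1) = x ^ (p - 1)] (mod int p)"
    by (intro cong_pow) (simp add: a)
  ultimately show ?thesis
    by (metis cong_sym cong_trans of_nat_1 of_nat_power)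
qed

text \<open>If \<open>p\<close> divides \<open>x\<close>, both sides vanish modulo \<open>p\<close>,
  as the exponent is positive; otherwise the exponent reduces modulo \<open>p - 1\<close> by
  \<open>fermat_int\<close>.\<close>

lemma power_cong_self:
  fixes x :: int
  assumes "prime p" "d \<ge> 1" "[d = 1] (mod (p - 1))"
  shows "[x ^ d = x] (mod int p)"
proof (cases "int p dvd x")
  case True
  then have "int p dvd x ^ d"
    using assms(2) by (simp add: dvd_trans[OF _ dvd_power])
  with True show ?thesis
    by (simp add: cong_def)
next
  case False
  \<comment> \<open>Since \<open>d \<ge> 1\<close>, the natural subtraction \<open>d - 1\<close> is
    exact, and \<open>k\<close> is its quotient by \<open>p - 1\<close>.\<close>
  obtain k where k: "d = 1 + (p - 1) * k"
    using assms(2) cong_to_1_nat[OF assms(3)] by (metis dvdE le_add_diff_inverse)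
  have "[(x ^ (p - 1)) ^ k = 1 ^ k] (mod int p)"
    by (intro cong_pow fermat_int assms False)
  then have "[x * (x ^ (p - 1)) ^ k = x * 1] (mod int p)"
    by (intro cong_mult) auto
  then show ?thesis
    by (simp add: k power_add power_mult)
qed

lemma phi_iterate_Suc: "(phi d c ^^ Suc n) 0 = ((phi d c ^^ n) 0) ^ d + c"
  by (simp add: phi_def[of d c "(phi d c ^^ n) 0"])

text \<open>The multiples of \<open>m\<close> contain 0 and are closed under \<open>phi d c\<close>:
  a positive power of a multiple is a multiple, and so is \<open>c\<close>.\<close>

lemma dvd_phi_iterate:
  assumes "m dvd c" "d \<ge> 1"
  shows "m dvd (phi d c ^^ n) 0"
proof (induction n)
  case (Suc n)
  then have "m dvd ((phi d c ^^ n) 0) ^ d"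
    using assms(2) by (simp add: dvd_trans[OF _ dvd_power])
  with assms(1) show ?case
    unfolding phi_iterate_Suc by (intro dvd_add)
qed simp

lemma phi_iterate_cong:
  assumes "prime p" "d \<ge> 1" "[d = 1] (mod (p - 1))"
  shows "[(phi d c ^^ n) 0 = int n * c] (mod int p)"
proof (induction n)
  case (Suc n)
  have "[((phi d c ^^ n) 0) ^ d + c = int n * c + c] (mod int p)"
    \<comment> \<open>\<open>power_cong_self\<close> strips the exponent from the iterate, to which
      the induction hypothesis then applies.\<close>
    by (intro cong_add cong_refl cong_trans[OF power_cong_self[OF assms] Suc])
  then show ?case
    unfolding phi_iterate_Suc by (simp add: algebra_simps)
qed simp

lemma divisor_in_D_set:
  assumes "n \<ge> 1" "int n dvd c" "d \<ge> 1"
  shows "n \<in> D_set d c"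
  using assms by (simp add: D_set_def dvd_phi_iterate)

lemma prime_in_P_set:
  assumes "prime p" "d \<ge> 1" "[d = 1] (mod (p - 1))"
  shows "p \<in> P_set d c"
proof -
  have "int p dvd (phi d c ^^ p) 0"
    \<comment> \<open>After exactly \<open>p\<close> iterations the value is congruent to
      \<open>int p * c\<close>, a multiple of \<open>p\<close> for every \<open>c\<close>.\<close>
    using cong_dvd_iff[OF phi_iterate_cong[OF assms, of p c]] by simp
  then show ?thesis
    using prime_ge_1_nat[OF assms(1)] assms(1) by (simp add: P_set_def D_set_def)
qed

theorem theorem1p5:
  fixes d :: nat and c :: int
  assumes "d \<ge> 2"
  shows "2 \<in> P_set d c
    \<and> (\<forall>n::nat. n \<ge> 1 \<longrightarrow> int n dvd c \<longrightarrow> n \<in> D_set d c)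
    \<and> (\<forall>p::nat. prime p \<longrightarrow> int p dvd c \<longrightarrow> p \<in> P_set d c)
    \<and> (\<forall>p::nat. prime p \<longrightarrow> [d = 1] (mod (p - 1)) \<longrightarrow> p \<in> P_set d c)"
proof (intro conjI allI impI)
  have d: "d \<ge> 1"
    using assms by simp
  show "2 \<in> P_set d c"
    \<comment> \<open>Here \<open>p - 1\<close> is 1, and all numbers are congruent modulo
      1.\<close>
    by (rule prime_in_P_set) (use d in auto)
  show "n \<in> D_set d c" if "n \<ge> 1" "int n dvd c" for n
    using divisor_in_D_set that d .
  show "p \<in> P_set d c" if "prime p" "int p dvd c" for p
    using divisor_in_D_set[OF prime_ge_1_nat] that d by (simp add: P_set_def)
  show "p \<in> P_set d c" if "prime p" "[d = 1] (mod (p - 1))" for p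
    using prime_in_P_set that d by blast
qed

end
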